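(* Let $(\rho,\overline{J},\overline{E},\overline{B})$ satisfy Maxwell's equations. Then $$\square^{2}(\overline{E})=\frac{\nabla\rho}{\epsilon_{0}}+\mu_{0}\frac{\partial\overline{J}}{\partial t},\qquad \square^{2}(\overline{B})=-\mu_{0}(\nabla\times\overline{J}).$$
   Context: All quantities are smooth functions of $(\overline{x},t)\in\mathbb{R}^{3}\times\mathbb{R}$, with $\rho$ scalar valued and $\overline{J},\overline{E},\overline{B}$ vector valued. $\epsilon_{0},\mu_{0}>0$ are constants. $\square^{2}=\nabla^{2}-\mu_{0}\epsilon_{0}\frac{\partial^{2}}{\partial t^{2}}$, acting componentwise on vector fields. Maxwell's equations for $(\rho,\overline{J},\overline{E},\overline{B})$ are: $\nabla\cdot\overline{E}=\rho/\epsilon_{0}$, $\nabla\cdot\overline{B}=0$, $\nabla\times\overline{E}=-\frac{\partial\overline{B}}{\partial t}$, $\nabla\times\overline{B}=\mu_{0}\overline{J}+\mu_{0}\epsilon_{0}\frac{\partial\overline{E}}{\partial t}$. *)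

theory Defs
  imports "HOL-Analysis.Analysis"
begin

text \<open>
  This is the usual class \<open>C\<^sup>k\<close>: the derivative of \<open>f\<close> is of class \<open>C\<^sup>k\<close> iff its values on the
  coordinate basis vectors are, and the derivative is a true value (not an arbitrary choice)
  because differentiability is required first.
\<close>

primrec Ck :: "nat \<Rightarrow> ('a::euclidean_space \<Rightarrow> 'b::real_normed_vector) \<Rightarrow> bool" where
  "Ck 0 f \<longleftrightarrow> continuous_on UNIV f"
| "Ck (Suc k) f \<longleftrightarrow>
     (\<forall>p. f differentiable (at p)) \<and> (\<forall>b\<in>Basis. Ck k (\<lambda>p. frechet_derivative f (at p) b))"

definition smooth :: "('a::euclidean_space \<Rightarrow> 'b::real_normed_vector) \<Rightarrow> bool" where
  "smooth f \<longleftrightarrow> (\<forall>k. Ck k f)"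

text \<open>
  Points of space-time are pairs \<open>(x, t)\<close>. The operators \<open>grad\<close>, \<open>divergence\<close>, \<open>curl\<close> and
  \<open>laplacian\<close> below differentiate in \<open>x\<close> only.
\<close>

type_synonym 'b field_on_spacetime = "(real ^ 3) \<times> real \<Rightarrow> 'b"

definition partial_space ::
    "3 \<Rightarrow> 'b::real_normed_vector field_on_spacetime \<Rightarrow> 'b field_on_spacetime" where
  "partial_space i f = (\<lambda>(x, t). vector_derivative (\<lambda>s. f (x + s *\<^sub>R axis i 1, t)) (at 0))"

definition partial_time ::
    "'b::real_normed_vector field_on_spacetime \<Rightarrow> 'b field_on_spacetime" where
  "partial_time f = (\<lambda>(x, t). vector_derivative (\<lambda>s. f (x, s)) (at t))"

definition grad :: "real field_on_spacetime \<Rightarrow> (real ^ 3) field_on_spacetime" where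
  "grad f = (\<lambda>p. \<chi> i. partial_space i f p)"

definition divergence :: "(real ^ 3) field_on_spacetime \<Rightarrow> real field_on_spacetime" where
  "divergence F = (\<lambda>p. \<Sum>i\<in>UNIV. partial_space i (\<lambda>q. F q $ i) p)"

definition curl :: "(real ^ 3) field_on_spacetime \<Rightarrow> (real ^ 3) field_on_spacetime" where
  "curl F = (\<lambda>p. vector
     [partial_space 2 (\<lambda>q. F q $ 3) p - partial_space 3 (\<lambda>q. F q $ 2) p,
      partial_space 3 (\<lambda>q. F q $ 1) p - partial_space 1 (\<lambda>q. F q $ 3) p,
      partial_space 1 (\<lambda>q. F q $ 2) p - partial_space 2 (\<lambda>q. F q $ 1) p])"

definition laplacian :: "real field_on_spacetime \<Rightarrow> real field_on_spacetime" where
  "laplacian f = (\<lambda>p. \<Sum>i\<in>UNIV. partial_space i (partial_space i f) p)"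

definition dalembertian :: "real \<Rightarrow> real \<Rightarrow> real field_on_spacetime \<Rightarrow> real field_on_spacetime" where
  "dalembertian \<epsilon>\<^sub>0 \<mu>\<^sub>0 f =
     (\<lambda>p. laplacian f p - \<mu>\<^sub>0 * \<epsilon>\<^sub>0 * partial_time (partial_time f) p)"

definition vec_dalembertian ::
    "real \<Rightarrow> real \<Rightarrow> (real ^ 3) field_on_spacetime \<Rightarrow> (real ^ 3) field_on_spacetime" where
  "vec_dalembertian \<epsilon>\<^sub>0 \<mu>\<^sub>0 F = (\<lambda>p. \<chi> i. dalembertian \<epsilon>\<^sub>0 \<mu>\<^sub>0 (\<lambda>q. F q $ i) p)"

definition maxwell_equations ::
    "real \<Rightarrow> real \<Rightarrow> real field_on_spacetime \<Rightarrow> (real ^ 3) field_on_spacetime \<Rightarrow>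
     (real ^ 3) field_on_spacetime \<Rightarrow> (real ^ 3) field_on_spacetime \<Rightarrow> bool" where
  "maxwell_equations \<epsilon>\<^sub>0 \<mu>\<^sub>0 \<rho> J E B \<longleftrightarrow>
     (\<forall>p. divergence E p = \<rho> p / \<epsilon>\<^sub>0) \<and>
     (\<forall>p. divergence B p = 0) \<and>
     (\<forall>p. curl E p = - partial_time B p) \<and>
     (\<forall>p. curl B p = \<mu>\<^sub>0 *\<^sub>R J p + (\<mu>\<^sub>0 * \<epsilon>\<^sub>0) *\<^sub>R partial_time E p)"

end

theory Submission
  imports Defs
begin

text \<open>
  Both wave equations come from the identity
  \<open>\<nabla> \<times> (\<nabla> \<times> F) = \<nabla>(\<nabla> \<cdot> F) - \<nabla>\<^sup>2 F\<close> (\<open>curl_curl\<close>) together with the fact that the curl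
  commutes with \<open>\<partial>/\<partial>t\<close> (\<open>partial_time_curl\<close>). Taking the curl of Faraday's law and
  substituting Gauss's and Ampere's laws gives
  \<open>\<nabla>\<^sup>2 E = \<nabla>\<rho>/\<epsilon>\<^sub>0 + \<partial>/\<partial>t (\<nabla> \<times> B) = \<nabla>\<rho>/\<epsilon>\<^sub>0 + \<mu>\<^sub>0 \<partial>J/\<partial>t + \<mu>\<^sub>0 \<epsilon>\<^sub>0 \<partial>\<^sup>2E/\<partial>t\<^sup>2\<close>;
  taking the curl of Ampere's law and substituting Faraday's law and \<open>\<nabla> \<cdot> B = 0\<close> gives
  \<open>\<nabla>\<^sup>2 B = - \<mu>\<^sub>0 \<nabla> \<times> J + \<mu>\<^sub>0 \<epsilon>\<^sub>0 \<partial>\<^sup>2B/\<partial>t\<^sup>2\<close>.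

  The analytic content is the symmetry of mixed second derivatives (\<open>dir_deriv_commute\<close>),
  obtained from the mean value theorem applied twice to the second difference of a function.
  The partial derivatives in space and time are all values of the Frechet derivative on
  basis vectors, so this single statement covers every pair of them.
\<close>

section \<open>Directional derivatives and their symmetry\<close>

definition dir_deriv ::
    "'a::real_normed_vector \<Rightarrow> ('a \<Rightarrow> 'b::real_normed_vector) \<Rightarrow> 'a \<Rightarrow> 'b" where
  "dir_deriv b f = (\<lambda>p. frechet_derivative f (at p) b)"

lemma has_derivative_imp_dir_deriv:
  "(f has_derivative f') (at p) \<Longrightarrow> dir_deriv b f p = f' b"
  unfolding dir_deriv_def by (metis frechet_derivative_at)

lemma has_vector_derivative_along_line:
  assumes "f differentiable (at (p + r *\<^sub>R a))"
  shows "((\<lambda>s. f (p + s *\<^sub>R a)) has_vector_derivative dir_deriv a f (p + r *\<^sub>R a)) (at r)"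
proof -
  let ?f' = "frechet_derivative f (at (p + r *\<^sub>R a))"
  have f': "(f has_derivative ?f') (at (p + r *\<^sub>R a))"
    using assms by (simp add: frechet_derivative_works)
  have line: "((\<lambda>s. p + s *\<^sub>R a) has_derivative (\<lambda>s. s *\<^sub>R a)) (at r)"
    by (auto intro!: derivative_eq_intros)
  have "((\<lambda>s. f (p + s *\<^sub>R a)) has_derivative (\<lambda>s. ?f' (s *\<^sub>R a))) (at r)"
    using diff_chain_at[OF line f'] by (simp add: o_def)
  then show ?thesis
    using linear_scale[OF linear_frechet_derivative[OF assms]]
    by (simp add: has_vector_derivative_def dir_deriv_def)
qed

lemma dir_deriv_bounded_linear:
  assumes "bounded_linear L" and "f differentiable (at p)"
  shows "dir_deriv b (\<lambda>q. L (f q)) p = L (dir_deriv b f p)"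
proof -
  have "((\<lambda>q. L (f q)) has_derivative (\<lambda>h. L (frechet_derivative f (at p) h))) (at p)"
    using assms bounded_linear.has_derivative frechet_derivative_works by blast
  then show ?thesis
    by (metis has_derivative_imp_dir_deriv dir_deriv_def)
qed

lemma dir_deriv_add:
  assumes "f differentiable (at p)" and "g differentiable (at p)"
  shows "dir_deriv b (\<lambda>q. f q + g q) p = dir_deriv b f p + dir_deriv b g p"
proof -
  have "((\<lambda>q. f q + g q) has_derivative
      (\<lambda>h. frechet_derivative f (at p) h + frechet_derivative g (at p) h)) (at p)"
    using assms has_derivative_add frechet_derivative_works by blast
  then show ?thesis
    using has_derivative_imp_dir_deriv by (fastforce simp: dir_deriv_def)
qed

text \<open>
  For a fixed \<open>s\<close>, apply the mean value theorem first to \<open>r \<mapsto> f (p + ra + sb) - f (p + ra)\<close>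
  and then, at the intermediate point, to \<open>dir_deriv a f\<close> in the direction \<open>b\<close>. The left-hand
  side does not change when \<open>a\<close> and \<open>b\<close> are exchanged, which is what makes the mixed
  derivatives agree in the limit.
\<close>

lemma second_difference_mean_value:
  fixes f :: "'a::real_normed_vector \<Rightarrow> real"
  assumes f: "\<And>q. f differentiable (at q)" and fa: "\<And>q. dir_deriv a f differentiable (at q)"
    and s: "s > 0"
  shows "\<exists>\<xi> \<eta>. 0 < \<xi> \<and> \<xi> < s \<and> 0 < \<eta> \<and> \<eta> < s \<and>
    f (p + s *\<^sub>R a + s *\<^sub>R b) - f (p + s *\<^sub>R a) - f (p + s *\<^sub>R b) + f p
      = s\<^sup>2 * dir_deriv b (dir_deriv a f) (p + \<xi> *\<^sub>R a + \<eta> *\<^sub>R b)"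
proof -
  define g where "g r = f ((p + s *\<^sub>R b) + r *\<^sub>R a) - f (p + r *\<^sub>R a)" for r
  have g': "DERIV g r :> dir_deriv a f ((p + s *\<^sub>R b) + r *\<^sub>R a) - dir_deriv a f (p + r *\<^sub>R a)" for r
    unfolding g_def has_real_derivative_iff_has_vector_derivative
    by (intro has_vector_derivative_diff has_vector_derivative_along_line f)
  obtain \<xi> where \<xi>: "0 < \<xi>" "\<xi> < s"
    and g_eq: "g s - g 0
      = (s - 0) * (dir_deriv a f ((p + s *\<^sub>R b) + \<xi> *\<^sub>R a) - dir_deriv a f (p + \<xi> *\<^sub>R a))"
    using MVT2[OF s g'] by blast
  define h where "h r = dir_deriv a f ((p + \<xi> *\<^sub>R a) + r *\<^sub>R b)" for r
  have h': "DERIV h r :> dir_deriv b (dir_deriv a f) ((p + \<xi> *\<^sub>R a) + r *\<^sub>R b)" for r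
    unfolding h_def has_real_derivative_iff_has_vector_derivative
    by (intro has_vector_derivative_along_line fa)
  obtain \<eta> where \<eta>: "0 < \<eta>" "\<eta> < s"
    and h_eq: "h s - h 0 = (s - 0) * dir_deriv b (dir_deriv a f) ((p + \<xi> *\<^sub>R a) + \<eta> *\<^sub>R b)"
    using MVT2[OF s h'] by blast
  have "f (p + s *\<^sub>R a + s *\<^sub>R b) - f (p + s *\<^sub>R a) - f (p + s *\<^sub>R b) + f p = g s - g 0"
    by (simp add: g_def algebra_simps)
  also have "\<dots> = s * (h s - h 0)"
    by (simp add: g_eq h_def algebra_simps)
  also have "\<dots> = s\<^sup>2 * dir_deriv b (dir_deriv a f) (p + \<xi> *\<^sub>R a + \<eta> *\<^sub>R b)"
    by (simp add: h_eq power2_eq_square)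
  finally show ?thesis
    using \<xi> \<eta> by blast
qed

text \<open>
  Both intermediate points of the preceding lemma lie between \<open>0\<close> and \<open>s\<close>, so continuity of
  the mixed derivative at \<open>p\<close> identifies the limit.
\<close>

lemma second_difference_tendsto:
  fixes f :: "'a::real_normed_vector \<Rightarrow> real"
  assumes f: "\<And>q. f differentiable (at q)" and fa: "\<And>q. dir_deriv a f differentiable (at q)"
    and cont: "isCont (dir_deriv b (dir_deriv a f)) p"
  shows "((\<lambda>s. (f (p + s *\<^sub>R a + s *\<^sub>R b) - f (p + s *\<^sub>R a) - f (p + s *\<^sub>R b) + f p) / s\<^sup>2)
    \<longlongrightarrow> dir_deriv b (dir_deriv a f) p) (at_right 0)"
proof -
  define \<Delta> where
    "\<Delta> s = f (p + s *\<^sub>R a + s *\<^sub>R b) - f (p + s *\<^sub>R a) - f (p + s *\<^sub>R b) + f p" for s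
  have "\<exists>\<xi> \<eta>. s > 0 \<longrightarrow> 0 < \<xi> \<and> \<xi> < s \<and> 0 < \<eta> \<and> \<eta> < s \<and>
      \<Delta> s = s\<^sup>2 * dir_deriv b (dir_deriv a f) (p + \<xi> *\<^sub>R a + \<eta> *\<^sub>R b)" for s
    unfolding \<Delta>_def using second_difference_mean_value[where f = f, OF f fa] by blast
  then obtain \<xi> \<eta> where \<xi>\<eta>: "\<And>s. s > 0 \<Longrightarrow> 0 < \<xi> s \<and> \<xi> s < s \<and> 0 < \<eta> s \<and> \<eta> s < s \<and>
      \<Delta> s = s\<^sup>2 * dir_deriv b (dir_deriv a f) (p + \<xi> s *\<^sub>R a + \<eta> s *\<^sub>R b)"
    by metis
  have pos: "\<forall>\<^sub>F s in at_right (0::real). s > 0"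
    by (simp add: eventually_at_right_less)
  have id0: "((\<lambda>s::real. s) \<longlongrightarrow> 0) (at_right 0)"
    by (rule tendsto_ident_at)
  have \<xi>0: "(\<xi> \<longlongrightarrow> 0) (at_right 0)"
    by (rule tendsto_sandwich[OF _ _ tendsto_const id0])
      (use pos in \<open>eventually_elim, use \<xi>\<eta> in \<open>simp add: less_imp_le\<close>\<close>)+
  have \<eta>0: "(\<eta> \<longlongrightarrow> 0) (at_right 0)"
    by (rule tendsto_sandwich[OF _ _ tendsto_const id0])
      (use pos in \<open>eventually_elim, use \<xi>\<eta> in \<open>simp add: less_imp_le\<close>\<close>)+
  have "((\<lambda>s. p + \<xi> s *\<^sub>R a + \<eta> s *\<^sub>R b) \<longlongrightarrow> p + 0 *\<^sub>R a + 0 *\<^sub>R b) (at_right 0)"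
    by (intro tendsto_intros \<xi>0 \<eta>0)
  then have "((\<lambda>s. dir_deriv b (dir_deriv a f) (p + \<xi> s *\<^sub>R a + \<eta> s *\<^sub>R b))
      \<longlongrightarrow> dir_deriv b (dir_deriv a f) p) (at_right 0)"
    using isCont_tendsto_compose[OF cont] by simp
  moreover have "\<forall>\<^sub>F s in at_right 0.
      dir_deriv b (dir_deriv a f) (p + \<xi> s *\<^sub>R a + \<eta> s *\<^sub>R b) = \<Delta> s / s\<^sup>2"
    using pos by eventually_elim (use \<xi>\<eta> in simp)
  ultimately show ?thesis
    unfolding \<Delta>_def by (rule Lim_transform_eventually)
qed

section \<open>Smooth functions\<close>

lemma smooth_imp_continuous: "smooth f \<Longrightarrow> continuous_on UNIV f"
  unfolding smooth_def by (metis Ck.simps(1))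

lemma smooth_imp_differentiable: "smooth f \<Longrightarrow> f differentiable (at p)"
  unfolding smooth_def by (metis Ck.simps(2))

lemma smooth_dir_deriv: "smooth f \<Longrightarrow> b \<in> Basis \<Longrightarrow> smooth (dir_deriv b f)"
  unfolding smooth_def dir_deriv_def by (metis Ck.simps(2))

lemma Ck_bounded_linear:
  assumes "bounded_linear L"
  shows "Ck k f \<Longrightarrow> Ck k (\<lambda>p. L (f p))"
proof (induction k arbitrary: f)
  case 0
  then show ?case
    using bounded_linear.continuous_on[OF assms] by simp
next
  case (Suc k)
  have diff: "f differentiable (at p)" for p
    using Suc.prems by simp
  have "(\<lambda>q. L (f q)) differentiable (at p)" for p
    using bounded_linear.has_derivative[OF assms] diff unfolding differentiable_def by blast
  moreover have "Ck k (\<lambda>p. frechet_derivative (\<lambda>q. L (f q)) (at p) b)" if "b \<in> Basis" for b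
  proof -
    have "frechet_derivative (\<lambda>q. L (f q)) (at p) b = L (frechet_derivative f (at p) b)" for p
      using dir_deriv_bounded_linear[OF assms diff] by (simp add: dir_deriv_def)
    then show ?thesis
      using Suc that by simp
  qed
  ultimately show ?case
    by simp
qed

lemma smooth_bounded_linear: "bounded_linear L \<Longrightarrow> smooth f \<Longrightarrow> smooth (\<lambda>p. L (f p))"
  unfolding smooth_def using Ck_bounded_linear by blast

lemma smooth_vec_nth: "smooth F \<Longrightarrow> smooth (\<lambda>p. F p $ i)"
  by (rule smooth_bounded_linear[OF bounded_linear_vec_nth])

text \<open>
  Both iterated derivatives are limits of the same difference quotient, whose numerator is
  symmetric in the two directions.
\<close>

lemma dir_deriv_commute:
  fixes f :: "'a::euclidean_space \<Rightarrow> real"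
  assumes f: "smooth f" and a: "a \<in> Basis" and b: "b \<in> Basis"
  shows "dir_deriv a (dir_deriv b f) p = dir_deriv b (dir_deriv a f) p"
proof -
  have cont: "isCont (dir_deriv c (dir_deriv d f)) p" if "c \<in> Basis" "d \<in> Basis" for c d
    using smooth_imp_continuous[OF smooth_dir_deriv[OF smooth_dir_deriv[OF f that(2)] that(1)]]
    by (simp add: continuous_on_eq_continuous_at)
  note diff = smooth_imp_differentiable[OF f]
    and diff' = smooth_imp_differentiable[OF smooth_dir_deriv[OF f]]
  let ?Q = "\<lambda>s. (f (p + s *\<^sub>R a + s *\<^sub>R b) - f (p + s *\<^sub>R a) - f (p + s *\<^sub>R b) + f p) / s\<^sup>2"
  have "(?Q \<longlongrightarrow> dir_deriv b (dir_deriv a f) p) (at_right 0)"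
    by (rule second_difference_tendsto[OF diff diff'[OF a] cont[OF b a]])
  moreover have "(?Q \<longlongrightarrow> dir_deriv a (dir_deriv b f) p) (at_right 0)"
    using second_difference_tendsto[OF diff diff'[OF b] cont[OF a b]]
    by (simp add: algebra_simps)
  ultimately show ?thesis
    using tendsto_unique trivial_limit_at_right_real by blast
qed

section \<open>Partial derivatives on space-time\<close>

definition e_space :: "3 \<Rightarrow> (real ^ 3) \<times> real" where
  "e_space i = (axis i 1, 0)"

definition e_time :: "(real ^ 3) \<times> real" where
  "e_time = (0, 1)"

lemma e_space_Basis: "e_space i \<in> Basis"
  by (simp add: e_space_def Basis_prod_def)

lemma e_time_Basis: "e_time \<in> Basis"
  by (simp add: e_time_def Basis_prod_def)

lemma partial_space_eq_dir_deriv: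
  assumes "\<And>p. f differentiable (at p)"
  shows "partial_space i f = dir_deriv (e_space i) f"
proof
  fix p :: "(real ^ 3) \<times> real"
  obtain x t where p: "p = (x, t)"
    by (cases p)
  have "vector_derivative (\<lambda>s. f (p + s *\<^sub>R e_space i)) (at 0) = dir_deriv (e_space i) f p"
    using has_vector_derivative_along_line[of f p 0 "e_space i"] assms
    by (intro vector_derivative_at) simp
  then show "partial_space i f p = dir_deriv (e_space i) f p"
    by (simp add: partial_space_def p e_space_def)
qed

lemma partial_time_eq_dir_deriv:
  assumes "\<And>p. f differentiable (at p)"
  shows "partial_time f = dir_deriv e_time f"
proof
  fix p :: "(real ^ 3) \<times> real"
  obtain x t where p: "p = (x, t)"
    by (cases p)
  have "vector_derivative (\<lambda>s. f ((x, 0) + s *\<^sub>R e_time)) (at t)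
      = dir_deriv e_time f ((x, 0) + t *\<^sub>R e_time)"
    by (intro vector_derivative_at has_vector_derivative_along_line assms)
  then show "partial_time f p = dir_deriv e_time f p"
    by (simp add: partial_time_def p e_time_def)
qed

lemmas partial_space_smooth_eq = partial_space_eq_dir_deriv[OF smooth_imp_differentiable]
lemmas partial_time_smooth_eq = partial_time_eq_dir_deriv[OF smooth_imp_differentiable]

lemma smooth_partial_space: "smooth f \<Longrightarrow> smooth (partial_space i f)"
  by (simp add: partial_space_smooth_eq smooth_dir_deriv e_space_Basis)

lemma smooth_partial_time: "smooth f \<Longrightarrow> smooth (partial_time f)"
  by (simp add: partial_time_smooth_eq smooth_dir_deriv e_time_Basis)

lemma partial_space_commute:
  fixes f :: "real field_on_spacetime"
  assumes "smooth f"
  shows "partial_space i (partial_space j f) p = partial_space j (partial_space i f) p"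
  using dir_deriv_commute[OF assms e_space_Basis e_space_Basis] assms
  by (simp add: partial_space_smooth_eq smooth_dir_deriv e_space_Basis)

lemma partial_time_space_commute:
  fixes f :: "real field_on_spacetime"
  assumes "smooth f"
  shows "partial_time (partial_space i f) p = partial_space i (partial_time f) p"
  using dir_deriv_commute[OF assms e_time_Basis e_space_Basis] assms
  by (simp add: partial_space_smooth_eq partial_time_smooth_eq smooth_dir_deriv
      e_space_Basis e_time_Basis)

lemma partial_space_lincomb:
  fixes f g :: "real field_on_spacetime"
  assumes "\<And>p. f differentiable (at p)" and "\<And>p. g differentiable (at p)"
  shows "partial_space i (\<lambda>q. c * f q + d * g q) p = c * partial_space i f p + d * partial_space i g p"
  using assms
  by (simp add: partial_space_eq_dir_deriv dir_deriv_add
      dir_deriv_bounded_linear[OF bounded_linear_mult_right])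

lemma partial_space_diff:
  fixes f g :: "real field_on_spacetime"
  assumes "smooth f" and "smooth g"
  shows "partial_space i (\<lambda>q. f q - g q) p = partial_space i f p - partial_space i g p"
  using partial_space_lincomb[of f g i 1 "-1"] assms by (simp add: smooth_imp_differentiable)

lemma partial_space_sum:
  fixes f :: "'i \<Rightarrow> real field_on_spacetime"
  assumes "\<And>j. j \<in> S \<Longrightarrow> smooth (f j)"
  shows "partial_space i (\<lambda>q. \<Sum>j\<in>S. f j q) p = (\<Sum>j\<in>S. partial_space i (f j) p)"
proof -
  have deriv: "((\<lambda>q. \<Sum>j\<in>S. f j q) has_derivative
      (\<lambda>h. \<Sum>j\<in>S. frechet_derivative (f j) (at q) h)) (at q)" for q
    using assms smooth_imp_differentiable frechet_derivative_works
    by (intro has_derivative_sum) blast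
  then have "(\<lambda>q. \<Sum>j\<in>S. f j q) differentiable (at q)" for q
    using differentiable_def by blast
  then show ?thesis
    using has_derivative_imp_dir_deriv[OF deriv] assms
    by (simp add: partial_space_eq_dir_deriv partial_space_smooth_eq) (simp add: dir_deriv_def)
qed

lemma partial_time_lincomb:
  fixes f g :: "'b::real_normed_vector field_on_spacetime"
  assumes "\<And>p. f differentiable (at p)" and "\<And>p. g differentiable (at p)"
  shows "partial_time (\<lambda>q. c *\<^sub>R f q + d *\<^sub>R g q) p = c *\<^sub>R partial_time f p + d *\<^sub>R partial_time g p"
  using assms
  by (simp add: partial_time_eq_dir_deriv dir_deriv_add
      dir_deriv_bounded_linear[OF bounded_linear_scaleR_right])

lemma partial_time_vec_nth:
  assumes "\<And>p. F differentiable (at p)"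
  shows "partial_time F p $ i = partial_time (\<lambda>q. F q $ i) p"
proof -
  have "(\<lambda>q. F q $ i) differentiable (at q)" for q
    using bounded_linear.has_derivative[OF bounded_linear_vec_nth] assms
    unfolding differentiable_def by blast
  then show ?thesis
    by (simp add: assms partial_time_eq_dir_deriv dir_deriv_bounded_linear[OF bounded_linear_vec_nth])
qed

section \<open>Vector calculus\<close>

lemma curl_lincomb:
  assumes "smooth F" and "smooth G"
  shows "curl (\<lambda>q. c *\<^sub>R F q + d *\<^sub>R G q) p = c *\<^sub>R curl F p + d *\<^sub>R curl G p"
  using assms
  by (simp add: vec_eq_iff forall_3 curl_def partial_space_lincomb smooth_vec_nth
      smooth_imp_differentiable algebra_simps)

text \<open>
  In the component \<open>i\<close>, the term \<open>\<partial>\<^sub>i\<^sup>2 F\<^sub>i\<close> cancels between the gradient of the divergence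
  and the Laplacian. The other terms of the gradient are \<open>\<partial>\<^sub>i \<partial>\<^sub>j F\<^sub>j\<close>, whereas the iterated
  curl produces \<open>\<partial>\<^sub>j \<partial>\<^sub>i F\<^sub>j\<close>: the identity holds by the symmetry of second derivatives.
\<close>

lemma curl_curl:
  assumes "smooth F"
  shows "curl (curl F) p = grad (divergence F) p - (\<chi> i. laplacian (\<lambda>q. F q $ i) p)"
proof -
  have F: "smooth (\<lambda>q. F q $ i)" for i
    using assms by (rule smooth_vec_nth)
  have graddiv: "partial_space i (divergence F) p
      = (\<Sum>j\<in>UNIV. partial_space i (partial_space j (\<lambda>q. F q $ j)) p)" for i
    unfolding divergence_def by (simp add: partial_space_sum smooth_partial_space F)
  show ?thesis
    by (simp add: vec_eq_iff forall_3 curl_def grad_def graddiv laplacian_def sum_3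
        partial_space_diff smooth_partial_space F partial_space_commute[OF F, of 2 1]
        partial_space_commute[OF F, of 3 1] partial_space_commute[OF F, of 3 2])
qed

lemma curl_differentiable:
  assumes "smooth F"
  shows "curl F differentiable (at p)"
proof -
  have comp: "(\<lambda>q. curl F q $ i) differentiable (at p)" for i
    using exhaust_3[of i] assms
    by (elim disjE) (simp_all add: curl_def differentiable_diff smooth_imp_differentiable
        smooth_partial_space smooth_vec_nth)
  show ?thesis
    using comp unfolding differentiable_componentwise_within[of "curl F"]
    by (auto simp: Basis_vec_def inner_axis)
qed

text \<open>
  The curl is built from mixed derivatives in which \<open>\<partial>/\<partial>t\<close> may be moved inside. Comparing
  components needs the curl to be differentiable as a vector field, since otherwise the
  vector derivative in time and those of its components need not be related.
\<close>

lemma partial_time_curl: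
  assumes "smooth F"
  shows "partial_time (curl F) p = curl (partial_time F) p"
proof -
  have F: "smooth (\<lambda>q. F q $ i)" for i
    using assms by (rule smooth_vec_nth)
  have diff: "partial_time (\<lambda>q. f q - g q) p = partial_time f p - partial_time g p"
    if "smooth f" "smooth g" for f g :: "real field_on_spacetime"
    using partial_time_lincomb[of f g 1 "-1"] that by (simp add: smooth_imp_differentiable)
  have comp: "(\<lambda>q. partial_time F q $ i) = partial_time (\<lambda>q. F q $ i)" for i
    by (simp add: partial_time_vec_nth smooth_imp_differentiable assms)
  have "partial_time (curl F) p $ i = curl (partial_time F) p $ i" for i
    unfolding partial_time_vec_nth[OF curl_differentiable[OF assms]]
    using exhaust_3[of i]
    by (auto simp: curl_def comp diff smooth_partial_space F partial_time_space_commute)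
  then show ?thesis
    by (simp add: vec_eq_iff)
qed

text \<open>
  This form of the wave operator involves only the divergence, the curl and the time
  derivative of the field, which are the quantities that Maxwell's equations prescribe.
\<close>

lemma vec_dalembertian_eq:
  assumes "smooth F"
  shows "vec_dalembertian \<epsilon>\<^sub>0 \<mu>\<^sub>0 F p = grad (divergence F) p - curl (curl F) p
    - (\<mu>\<^sub>0 * \<epsilon>\<^sub>0) *\<^sub>R partial_time (partial_time F) p"
proof -
  have "(\<lambda>q. partial_time F q $ i) = partial_time (\<lambda>q. F q $ i)" for i
    by (simp add: partial_time_vec_nth smooth_imp_differentiable assms)
  then have "partial_time (partial_time F) p $ i = partial_time (partial_time (\<lambda>q. F q $ i)) p"
    for i
    by (simp add: partial_time_vec_nth smooth_imp_differentiable smooth_partial_time assms)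
  then show ?thesis
    by (simp add: vec_eq_iff curl_curl[OF assms] vec_dalembertian_def dalembertian_def)
qed

section \<open>The wave equations\<close>

theorem lemma2p3:
  fixes \<epsilon>\<^sub>0 \<mu>\<^sub>0 :: real
    and \<rho> :: "(real ^ 3) \<times> real \<Rightarrow> real"
    and J E B :: "(real ^ 3) \<times> real \<Rightarrow> real ^ 3"
  assumes "\<epsilon>\<^sub>0 > 0" and "\<mu>\<^sub>0 > 0"
    and "smooth \<rho>" and "smooth J" and "smooth E" and "smooth B"
    and "maxwell_equations \<epsilon>\<^sub>0 \<mu>\<^sub>0 \<rho> J E B"
  shows "(\<forall>p. vec_dalembertian \<epsilon>\<^sub>0 \<mu>\<^sub>0 E p
                 = (1 / \<epsilon>\<^sub>0) *\<^sub>R grad \<rho> p + \<mu>\<^sub>0 *\<^sub>R partial_time J p)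
       \<and> (\<forall>p. vec_dalembertian \<epsilon>\<^sub>0 \<mu>\<^sub>0 B p = - (\<mu>\<^sub>0 *\<^sub>R curl J p))"
proof -
  note J = \<open>smooth J\<close> and E = \<open>smooth E\<close> and B = \<open>smooth B\<close>
  have gauss: "divergence E = (\<lambda>p. \<rho> p / \<epsilon>\<^sub>0)" and "divergence B = (\<lambda>p. 0)"
    and faraday: "curl E = (\<lambda>p. - partial_time B p)"
    and ampere: "curl B = (\<lambda>p. \<mu>\<^sub>0 *\<^sub>R J p + (\<mu>\<^sub>0 * \<epsilon>\<^sub>0) *\<^sub>R partial_time E p)"
    using \<open>maxwell_equations \<epsilon>\<^sub>0 \<mu>\<^sub>0 \<rho> J E B\<close> by (auto simp: maxwell_equations_def)

  \<comment> \<open>A scalar multiple is treated as a linear combination whose second coefficient is \<open>0\<close>,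
    here and in the other instances below that repeat one function.\<close>
  have grad_div_E: "grad (divergence E) p = (1 / \<epsilon>\<^sub>0) *\<^sub>R grad \<rho> p" for p
    using partial_space_lincomb[of \<rho> \<rho> _ "1 / \<epsilon>\<^sub>0" 0 p] \<open>smooth \<rho>\<close>
    by (simp add: gauss grad_def vec_eq_iff smooth_imp_differentiable)
  have grad_div_B: "grad (divergence B) p = 0" for p
    using partial_space_lincomb[of "\<lambda>q. 0" "\<lambda>q. 0" _ 0 0 p] \<open>divergence B = (\<lambda>p. 0)\<close>
    by (simp add: grad_def vec_eq_iff)

  have "curl (curl E) p = - partial_time (curl B) p" for p
    using curl_lincomb[of "partial_time B" "partial_time B" "-1" 0 p]
    by (simp add: faraday partial_time_curl smooth_partial_time B)
  moreover have "partial_time (curl B) p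
      = \<mu>\<^sub>0 *\<^sub>R partial_time J p + (\<mu>\<^sub>0 * \<epsilon>\<^sub>0) *\<^sub>R partial_time (partial_time E) p" for p
    unfolding ampere
    by (simp add: partial_time_lincomb smooth_imp_differentiable smooth_partial_time J E)
  ultimately have wave_E: "vec_dalembertian \<epsilon>\<^sub>0 \<mu>\<^sub>0 E p
      = (1 / \<epsilon>\<^sub>0) *\<^sub>R grad \<rho> p + \<mu>\<^sub>0 *\<^sub>R partial_time J p" for p
    by (simp add: vec_dalembertian_eq E grad_div_E)

  have "curl (curl B) p = \<mu>\<^sub>0 *\<^sub>R curl J p + (\<mu>\<^sub>0 * \<epsilon>\<^sub>0) *\<^sub>R partial_time (curl E) p" for p
    unfolding ampere
    by (simp add: curl_lincomb partial_time_curl smooth_partial_time J E)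
  moreover have "partial_time (curl E) p = - partial_time (partial_time B) p" for p
    using partial_time_lincomb[of "partial_time B" "partial_time B" "-1" 0 p]
    by (simp add: faraday smooth_imp_differentiable smooth_partial_time B)
  ultimately have wave_B: "vec_dalembertian \<epsilon>\<^sub>0 \<mu>\<^sub>0 B p = - (\<mu>\<^sub>0 *\<^sub>R curl J p)" for p
    by (simp add: vec_dalembertian_eq B grad_div_B)

  show ?thesis
    using wave_E wave_B by blast
qed

end
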